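(* Let $0<q<1$ and let $a,b,c,d\in\mathbb{C}$ satisfy $a,b,c,d\neq0$, $abcd\neq q^{-m}$ for $m=0,1,2,\ldots$, $\{a,b\}\cap\{a^{-1},b^{-1}\}=\emptyset$, and $q^nab\neq1$ for $n=1,2,\ldots$. Let $E_n$ ($n\in\mathbb{Z}$) be the nonsymmetric Askey-Wilson polynomials with parameters $a,b,c,d$. Define a symmetric bilinear form on the space of Laurent polynomials by $$\langle g,h\rangle=\langle g_1,h_1\rangle_{a,b,c,d;q}-ab\,\frac{(1-ab)(1-qab)(1-ac)(1-ad)(1-bc)(1-bd)}{(1-abcd)(1-qabcd)}\,\langle g_2,h_2\rangle_{qa,qb,c,d;q},$$ where $g\leftrightarrow(g_1,g_2)$ and $h\leftrightarrow(h_1,h_2)$. Then $$\langle E_m,E_n\rangle=0\qquad(m,n\in\mathbb{Z},\ m\neq n).$$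
   Context: Pochhammer symbols: $(a;q)_n=\prod_{j=0}^{n-1}(1-aq^j)$, $(a_1,\ldots,a_r;q)_n=(a_1;q)_n\cdots(a_r;q)_n$. A Laurent polynomial $f[z]$ is symmetric if $f[z]=f[z^{-1}]$. Monic Askey-Wilson polynomials: $$P_n[z]=P_n[z;a,b,c,d\mid q]=\frac{(ab,ac,ad;q)_n}{a^n(abcdq^{n-1};q)_n}\sum_{k=0}^n\frac{(q^{-n},q^{n-1}abcd,az,az^{-1};q)_k}{(ab,ac,ad,q;q)_k}q^k,$$ with the factor $(ab,ac,ad;q)_n$ multiplied through and cancelled against the denominators. The $P_n$ ($n\ge0$) form a basis of the space of symmetric Laurent polynomials. The symmetric bilinear form $\langle\cdot,\cdot\rangle_{a,b,c,d;q}$ on symmetric Laurent polynomials is determined by $$\langle P_m,P_n\rangle_{a,b,c,d;q}=h_n\,\delta_{m,n},\qquad h_n=\frac{(q,ab,ac,ad,bc,bd,cd;q)_n}{(abcd;q)_{2n}(q^{n-1}abcd;q)_n};$$ $\langle\cdot,\cdot\rangle_{qa,qb,c,d;q}$ is the same with $(a,b,c,d)$ replaced by $(qa,qb,c,d)$ everywhere. Nonsymmetric Askey-Wilson polynomials: with $Q_n[z]=a^{-1}b^{-1}z^{-1}(1-az)(1-bz)P_{n-1}[z;qa,qb,c,d\mid q]$, $$E_{-n}=P_n-Q_n\quad(n=1,2,\ldots),\qquad E_n=P_n-\frac{ab(1-q^n)(1-q^{n-1}cd)}{(1-q^nab)(1-q^{n-1}abcd)}\,Q_n\quad(n=0,1,2,\ldots),$$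 with the convention $(1-q^n)Q_n=0$ for $n=0$ (so $E_0=P_0=1$). A Laurent polynomial $f$ is identified with the pair $(f_1,f_2)$ of symmetric Laurent polynomials uniquely determined by $f[z]=f_1[z]+z^{-1}(1-az)(1-bz)f_2[z]$. *)

theory Defs
  imports Complex_Main "HOL-Library.Poly_Mapping"
begin

text \<open>
  The ring of complex Laurent polynomials is the monoid algebra of the additive group of the
  integers: \<open>lookup f k\<close> is the coefficient of \<open>z\<^sup>k\<close>, and \<open>single k x\<close> is
  \<open>x z\<^sup>k\<close>.
\<close>

type_synonym laurent = "int \<Rightarrow>\<^sub>0 complex"

definition lconst :: "complex \<Rightarrow> laurent" where
  "lconst x = Poly_Mapping.single 0 x"

definition symmetric_laurent :: "laurent \<Rightarrow> bool" where
  "symmetric_laurent f \<longleftrightarrow> (\<forall>k. Poly_Mapping.lookup f (- k) = Poly_Mapping.lookup f k)"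

text \<open>Defined over any commutative ring, as it is used both for numbers and for \<open>(az; q)\<^sub>k\<close>.\<close>

definition qpoch :: "'a::comm_ring_1 \<Rightarrow> 'a \<Rightarrow> nat \<Rightarrow> 'a" where
  "qpoch x q n = (\<Prod>j<n. 1 - x * q ^ j)"

text \<open>
  The monic Askey-Wilson polynomial. The factor \<open>(ab, ac, ad; q)\<^sub>n / (ab, ac, ad; q)\<^sub>k\<close> is
  cancelled to \<open>(abq\<^sup>k, acq\<^sup>k, adq\<^sup>k; q)\<close> with subscript \<open>n - k\<close>, so that it makes sense also
  when \<open>ab\<close>, \<open>ac\<close> or \<open>ad\<close> is a nonpositive power of \<open>q\<close>.
\<close>

definition aw_poly ::
    "complex \<Rightarrow> complex \<Rightarrow> complex \<Rightarrow> complex \<Rightarrow> complex \<Rightarrow> nat \<Rightarrow> laurent" where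
  "aw_poly a b c d q n =
     lconst (1 / (a ^ n * qpoch (a * b * c * d * q powi (int n - 1)) q n)) *
     (\<Sum>k\<le>n.
        lconst (qpoch (q powi (- int n)) q k * qpoch (q powi (int n - 1) * a * b * c * d) q k *
                qpoch (a * b * q ^ k) q (n - k) * qpoch (a * c * q ^ k) q (n - k) *
                qpoch (a * d * q ^ k) q (n - k) / qpoch q q k * q ^ k) *
        qpoch (Poly_Mapping.single 1 a) (lconst q) k *
        qpoch (Poly_Mapping.single (- 1) a) (lconst q) k)"

definition aw_norm ::
    "complex \<Rightarrow> complex \<Rightarrow> complex \<Rightarrow> complex \<Rightarrow> complex \<Rightarrow> nat \<Rightarrow> complex" where
  "aw_norm a b c d q n =
     qpoch q q n * qpoch (a * b) q n * qpoch (a * c) q n * qpoch (a * d) q n *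
     qpoch (b * c) q n * qpoch (b * d) q n * qpoch (c * d) q n /
     (qpoch (a * b * c * d) q (2 * n) * qpoch (q powi (int n - 1) * a * b * c * d) q n)"

text \<open>
  The coordinates of a symmetric Laurent polynomial in the basis \<open>aw_poly a b c d q n\<close>
  (a basis whenever \<open>a\<close> and \<open>q\<close> are nonzero, \<open>q\<close> is not a root of unity and \<open>abcd\<close> is not
  \<open>q\<close> to a nonpositive integer power), and the bilinear form which is diagonal in this basis.
  Both are meaningful on symmetric Laurent polynomials only.
\<close>

definition aw_coord ::
    "complex \<Rightarrow> complex \<Rightarrow> complex \<Rightarrow> complex \<Rightarrow> complex \<Rightarrow> laurent \<Rightarrow> nat \<Rightarrow>\<^sub>0 complex" where
  "aw_coord a b c d q f =
     (THE x. f = (\<Sum>n\<in>Poly_Mapping.keys x.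
        lconst (Poly_Mapping.lookup x n) * aw_poly a b c d q n))"

definition aw_form ::
    "complex \<Rightarrow> complex \<Rightarrow> complex \<Rightarrow> complex \<Rightarrow> complex \<Rightarrow> laurent \<Rightarrow> laurent \<Rightarrow> complex" where
  "aw_form a b c d q f g =
     (let x = aw_coord a b c d q f; y = aw_coord a b c d q g
      in \<Sum>n\<in>Poly_Mapping.keys x \<inter> Poly_Mapping.keys y.
           Poly_Mapping.lookup x n * Poly_Mapping.lookup y n * aw_norm a b c d q n)"

text \<open>The Laurent polynomial \<open>z\<^sup>-\<^sup>1 (1 - az) (1 - bz)\<close>.\<close>

definition aw_factor :: "complex \<Rightarrow> complex \<Rightarrow> laurent" where
  "aw_factor a b = Poly_Mapping.single (- 1) 1 *
     (1 - Poly_Mapping.single 1 a) * (1 - Poly_Mapping.single 1 b)"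

text \<open>
  The value at \<open>n = 0\<close> implements the convention \<open>(1 - q\<^sup>n) Q\<^sub>n = 0\<close> for \<open>n = 0\<close>.
\<close>

definition aw_Q ::
    "complex \<Rightarrow> complex \<Rightarrow> complex \<Rightarrow> complex \<Rightarrow> complex \<Rightarrow> nat \<Rightarrow> laurent" where
  "aw_Q a b c d q n =
     (if n = 0 then 0
      else lconst (1 / (a * b)) * aw_factor a b * aw_poly (q * a) (q * b) c d q (n - 1))"

definition nonsym_aw_poly ::
    "complex \<Rightarrow> complex \<Rightarrow> complex \<Rightarrow> complex \<Rightarrow> complex \<Rightarrow> int \<Rightarrow> laurent" where
  "nonsym_aw_poly a b c d q n =
     (if n < 0 then aw_poly a b c d q (nat (- n)) - aw_Q a b c d q (nat (- n))
      else aw_poly a b c d q (nat n) -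
           lconst (a * b * (1 - q powi n) * (1 - q powi (n - 1) * c * d) /
                   ((1 - q powi n * a * b) * (1 - q powi (n - 1) * a * b * c * d))) *
           aw_Q a b c d q (nat n))"

text \<open>
  The pair \<open>(f\<^sub>1, f\<^sub>2)\<close> of symmetric Laurent polynomials identified with \<open>f\<close>; it exists and is
  unique whenever \<open>ab \<noteq> 1\<close>.
\<close>

definition sym_pair :: "complex \<Rightarrow> complex \<Rightarrow> laurent \<Rightarrow> laurent \<times> laurent" where
  "sym_pair a b f =
     (THE (f1, f2). symmetric_laurent f1 \<and> symmetric_laurent f2 \<and> f = f1 + aw_factor a b * f2)"

definition nonsym_aw_form ::
    "complex \<Rightarrow> complex \<Rightarrow> complex \<Rightarrow> complex \<Rightarrow> complex \<Rightarrow> laurent \<Rightarrow> laurent \<Rightarrow> complex" where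
  "nonsym_aw_form a b c d q g h =
     (let (g1, g2) = sym_pair a b g; (h1, h2) = sym_pair a b h
      in aw_form a b c d q g1 h1 -
         a * b * ((1 - a * b) * (1 - q * a * b) * (1 - a * c) * (1 - a * d) *
                  (1 - b * c) * (1 - b * d) /
                  ((1 - a * b * c * d) * (1 - q * a * b * c * d))) *
         aw_form (q * a) (q * b) c d q g2 h2)"

end

theory Submission
  imports Defs
begin

text \<open>
  The polynomial \<open>E\<^sub>n\<close> corresponds to the pair \<open>(P\<^sub>|\<^sub>n\<^sub>|, s\<^sub>n P'\<^sub>|\<^sub>n\<^sub>|\<^sub>-\<^sub>1)\<close>, where \<open>P'\<close> is the
  Askey-Wilson polynomial with parameters \<open>qa, qb, c, d\<close> and \<open>s\<^sub>n\<close> is a scalar. Both components of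
  the form are diagonal in the respective Askey-Wilson bases, so \<open>E\<^sub>m\<close> and \<open>E\<^sub>n\<close> are orthogonal
  for trivial reasons unless \<open>m = - n\<close>. In that case the two contributions are \<open>h\<^sub>n\<close> and a multiple
  of the shifted norm \<open>h'\<^sub>n\<^sub>-\<^sub>1\<close>, and they cancel because of the identity
  \<open>h\<^sub>n (1 - q\<^sup>n ab) (1 - q\<^sup>n\<^sup>-\<^sup>1 abcd) = C (1 - q\<^sup>n) (1 - q\<^sup>n\<^sup>-\<^sup>1 cd) h'\<^sub>n\<^sub>-\<^sub>1\<close>
  (\<open>aw_norm_Suc\<close>), with \<open>C\<close> the constant in front of the second component of the form.

  Since coordinates and pairs are specified by unique existence, two uniqueness facts are
  needed. The \<open>P\<^sub>n\<close> are linearly independent because \<open>P\<^sub>n\<close> has top coefficient at \<open>z\<^sup>n\<close>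
  (\<open>aw_coord_scaled\<close>). The pair of \<open>f\<close> is unique because \<open>f[z] - f[z\<^sup>-\<^sup>1]\<close> equals
  \<open>(ab - 1) (z - z\<^sup>-\<^sup>1) f\<^sub>2[z]\<close> (\<open>sym_pair_eqI\<close>).
\<close>

section \<open>Coefficients of Laurent polynomials\<close>

lemma lookup_single_times:
  "Poly_Mapping.lookup (Poly_Mapping.single k x * f) j = x * Poly_Mapping.lookup f (j - k)"
  for f :: laurent
proof -
  have "(j = k + i) = (i = j - k)" for i by auto
  then have "Sum_any (\<lambda>i. Poly_Mapping.lookup f i when j = k + i) =
      Poly_Mapping.lookup f (j - k)"
    by simp
  then have "Sum_any (\<lambda>l. Poly_Mapping.lookup (Poly_Mapping.single k x) l *
      Sum_any (\<lambda>i. Poly_Mapping.lookup f i when j = l + i)) =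
      Sum_any (\<lambda>l. (x * Poly_Mapping.lookup f (j - k)) when l = k)"
    by (intro Sum_any.cong) (auto simp: lookup_single when_def)
  then show ?thesis by (simp add: lookup_mult)
qed

lemma lookup_lconst_times:
  "Poly_Mapping.lookup (lconst x * f) j = x * Poly_Mapping.lookup f j"
  by (simp add: lconst_def lookup_single_times)

lemma lconst_mult: "lconst (x * y) = lconst x * lconst y"
  by (simp add: lconst_def mult_single)

lemma lookup_aw_factor_times:
  "Poly_Mapping.lookup (aw_factor a b * f) j =
     Poly_Mapping.lookup f (j + 1) - (a + b) * Poly_Mapping.lookup f j
     + a * b * Poly_Mapping.lookup f (j - 1)"
proof -
  have "aw_factor a b = Poly_Mapping.single (- 1) 1 - Poly_Mapping.single 0 (a + b)
      + Poly_Mapping.single 1 (a * b)"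
    by (simp add: aw_factor_def algebra_simps mult_single single_add)
  then show ?thesis
    by (simp add: ring_distribs lookup_add lookup_minus lookup_single_times)
qed

lemma symmetric_lconst_times:
  "symmetric_laurent f \<Longrightarrow> symmetric_laurent (lconst x * f)"
  by (simp add: symmetric_laurent_def lookup_lconst_times)

text \<open>A coefficient sequence of period two is not finitely supported unless it vanishes.\<close>

lemma laurent_eq_0_if_periodic:
  fixes f :: laurent
  assumes "\<And>k. Poly_Mapping.lookup f (k + 1) = Poly_Mapping.lookup f (k - 1)"
  shows "f = 0"
proof (rule poly_mapping_eqI, rule ccontr)
  fix k assume "Poly_Mapping.lookup f k \<noteq> Poly_Mapping.lookup (0 :: laurent) k"
  then have k: "Poly_Mapping.lookup f k \<noteq> 0" by simp
  have "Poly_Mapping.lookup f (k + 2 * int n) = Poly_Mapping.lookup f k" for n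
  proof (induction n)
    case (Suc n)
    have "Poly_Mapping.lookup f (k + 2 * int (Suc n)) =
        Poly_Mapping.lookup f ((k + 2 * int n + 1) + 1)"
      by (simp add: algebra_simps)
    also have "\<dots> = Poly_Mapping.lookup f (k + 2 * int n)"
      by (subst assms) simp
    finally show ?case using Suc by simp
  qed simp
  then have "range (\<lambda>n::nat. k + 2 * int n) \<subseteq> Poly_Mapping.keys f"
    using k by (auto simp: in_keys_iff)
  then have "finite (range (\<lambda>n::nat. k + 2 * int n))"
    using finite_keys finite_subset by blast
  moreover have "inj (\<lambda>n::nat. k + 2 * int n)"
    by (auto simp: inj_def)
  ultimately show False
    using finite_imageD by blast
qed

section \<open>Uniqueness of the symmetric pair\<close>

text \<open>
  Comparing \<open>f\<^sub>1 + z\<^sup>-\<^sup>1 (1 - az) (1 - bz) f\<^sub>2 = 0\<close> with its image under \<open>z \<mapsto> z\<^sup>-\<^sup>1\<close> gives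
  \<open>(ab - 1) (z - z\<^sup>-\<^sup>1) f\<^sub>2 = 0\<close>.
\<close>

lemma sym_pair_zero:
  assumes ab: "a * b \<noteq> 1"
    and f1: "symmetric_laurent f1" and f2: "symmetric_laurent f2"
    and eq: "f1 + aw_factor a b * f2 = 0"
  shows "f1 = 0 \<and> f2 = 0"
proof -
  let ?l = Poly_Mapping.lookup
  have coeff: "?l f1 k + (?l f2 (k + 1) - (a + b) * ?l f2 k + a * b * ?l f2 (k - 1)) = 0" for k
    using arg_cong[OF eq, of "\<lambda>f. ?l f k"] by (simp add: lookup_add lookup_aw_factor_times)
  have "?l f2 (k + 1) = ?l f2 (k - 1)" for k
  proof -
    have s: "?l f1 (- k) = ?l f1 k" "?l f2 (- k) = ?l f2 k"
        "?l f2 (- k + 1) = ?l f2 (k - 1)" "?l f2 (- k - 1) = ?l f2 (k + 1)"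
      using f1 f2 unfolding symmetric_laurent_def
      by (metis, metis, metis minus_diff_eq diff_conv_add_uminus add.commute,
          metis minus_add_distrib diff_conv_add_uminus)
    have "(1 - a * b) * (?l f2 (k + 1) - ?l f2 (k - 1)) = 0"
      using coeff[of k] coeff[of "- k"] unfolding s by algebra
    then show ?thesis using ab by simp
  qed
  then have "f2 = 0" by (rule laurent_eq_0_if_periodic)
  with eq show ?thesis by simp
qed

lemma sym_pair_eqI:
  assumes ab: "a * b \<noteq> 1"
    and f1: "symmetric_laurent f1" and f2: "symmetric_laurent f2"
  shows "sym_pair a b (f1 + aw_factor a b * f2) = (f1, f2)"
  unfolding sym_pair_def
proof (rule the_equality)
  fix p
  assume "case p of (g1, g2) \<Rightarrow> symmetric_laurent g1 \<and> symmetric_laurent g2 \<and>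
      f1 + aw_factor a b * f2 = g1 + aw_factor a b * g2"
  then obtain g1 g2 where p: "p = (g1, g2)" and g: "symmetric_laurent g1" "symmetric_laurent g2"
    and eq: "f1 + aw_factor a b * f2 = g1 + aw_factor a b * g2"
    by (cases p) auto
  have "symmetric_laurent (f1 - g1)" "symmetric_laurent (f2 - g2)"
    using f1 f2 g by (simp_all add: symmetric_laurent_def lookup_minus)
  moreover have "(f1 - g1) + aw_factor a b * (f2 - g2) = 0"
    using eq by (simp add: algebra_simps)
  ultimately have "f1 - g1 = 0 \<and> f2 - g2 = 0"
    by (rule sym_pair_zero[OF ab])
  then show "p = (f1, f2)" using p by simp
qed (use f1 f2 in simp)

section \<open>Triangular families\<close>

lemma triangular_independent:
  fixes p :: "nat \<Rightarrow> laurent"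
  assumes diag: "\<And>n. Poly_Mapping.lookup (p n) (int n) \<noteq> 0"
    and upper: "\<And>n m. n < m \<Longrightarrow> Poly_Mapping.lookup (p n) (int m) = 0"
    and eq: "(\<Sum>n\<in>Poly_Mapping.keys y. lconst (Poly_Mapping.lookup y n) * p n) = 0"
  shows "y = 0"
proof (rule ccontr)
  assume "y \<noteq> 0"
  then have ne: "Poly_Mapping.keys y \<noteq> {}" by simp
  define N where "N = Max (Poly_Mapping.keys y)"
  have N: "N \<in> Poly_Mapping.keys y" using ne by (simp add: N_def)
  have le: "n \<le> N" if "n \<in> Poly_Mapping.keys y" for n using that by (simp add: N_def)
  have "0 = (\<Sum>n\<in>Poly_Mapping.keys y.
      Poly_Mapping.lookup y n * Poly_Mapping.lookup (p n) (int N))"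
    using arg_cong[OF eq, of "\<lambda>f. Poly_Mapping.lookup f (int N)"]
    by (simp add: lookup_sum lookup_lconst_times)
  also have "\<dots> = Poly_Mapping.lookup y N * Poly_Mapping.lookup (p N) (int N)"
    by (subst sum.remove[OF _ N]) (auto intro!: sum.neutral upper dest!: le)
  finally show False using N diag by (simp add: in_keys_iff)
qed

lemma triangular_coord_unique:
  fixes p :: "nat \<Rightarrow> laurent"
  assumes diag: "\<And>n. Poly_Mapping.lookup (p n) (int n) \<noteq> 0"
    and upper: "\<And>n m. n < m \<Longrightarrow> Poly_Mapping.lookup (p n) (int m) = 0"
    and eq: "(\<Sum>n\<in>Poly_Mapping.keys x. lconst (Poly_Mapping.lookup x n) * p n) =
             (\<Sum>n\<in>Poly_Mapping.keys y. lconst (Poly_Mapping.lookup y n) * p n)"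
  shows "x = y"
proof -
  let ?S = "Poly_Mapping.keys x \<union> Poly_Mapping.keys y"
  have extend: "(\<Sum>n\<in>Poly_Mapping.keys w. lconst (Poly_Mapping.lookup w n) * p n) =
      (\<Sum>n\<in>?S. lconst (Poly_Mapping.lookup w n) * p n)" if "Poly_Mapping.keys w \<subseteq> ?S" for w
    by (rule sum.mono_neutral_left) (use that in \<open>auto simp: in_keys_iff lconst_def\<close>)
  have "Poly_Mapping.keys (x - y) \<subseteq> ?S"
    by (auto simp: in_keys_iff lookup_minus)
  from extend[OF this] have "(\<Sum>n\<in>Poly_Mapping.keys (x - y).
      lconst (Poly_Mapping.lookup (x - y) n) * p n) =
      (\<Sum>n\<in>?S. lconst (Poly_Mapping.lookup x n) * p n) -
      (\<Sum>n\<in>?S. lconst (Poly_Mapping.lookup y n) * p n)"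
    by (simp add: lookup_minus lconst_def single_diff left_diff_distrib sum_subtractf)
  also have "\<dots> = 0"
    using eq by (simp add: extend)
  finally have "x - y = 0"
    using triangular_independent[of p, OF diag upper] by blast
  then show ?thesis by simp
qed

section \<open>Askey-Wilson polynomials are symmetric and triangular\<close>

lemma qpoch_Suc: "qpoch x q (Suc n) = qpoch x q n * (1 - x * q ^ n)"
  by (simp add: qpoch_def)

lemma qpoch_Suc_shift: "qpoch x q (Suc n) = (1 - x) * qpoch (q * x) q n"
  unfolding qpoch_def by (subst prod.lessThan_Suc_shift) (simp add: ac_simps)

lemma qpoch_nonzero:
  fixes x :: complex
  assumes "\<And>j. j < n \<Longrightarrow> x * q ^ j \<noteq> 1"
  shows "qpoch x q n \<noteq> 0"
  using assms by (auto simp: qpoch_def)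

abbreviation aw_kernel :: "complex \<Rightarrow> complex \<Rightarrow> nat \<Rightarrow> laurent" where
  "aw_kernel a q k \<equiv> qpoch (Poly_Mapping.single 1 a) (lconst q) k *
     qpoch (Poly_Mapping.single (- 1) a) (lconst q) k"

lemma lconst_power: "lconst q ^ n = lconst (q ^ n)"
  by (induction n) (simp_all add: lconst_mult, simp add: lconst_def)

lemma aw_kernel_Suc:
  "aw_kernel a q (Suc k) =
     lconst (1 + (a * q ^ k)\<^sup>2) * aw_kernel a q k
     - Poly_Mapping.single 1 (a * q ^ k) * aw_kernel a q k
     - Poly_Mapping.single (- 1) (a * q ^ k) * aw_kernel a q k"
proof -
  have "Poly_Mapping.single i a * lconst q ^ k = Poly_Mapping.single i (a * q ^ k)" for i :: int
    unfolding lconst_power by (simp add: lconst_def mult_single)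
  moreover have "(1 - Poly_Mapping.single 1 u) * (1 - Poly_Mapping.single (- 1) u) =
      lconst (1 + u\<^sup>2) - Poly_Mapping.single 1 u - Poly_Mapping.single (- 1) u" for u
    by (simp add: lconst_def algebra_simps mult_single single_add power2_eq_square)
  ultimately have "aw_kernel a q (Suc k) = (lconst (1 + (a * q ^ k)\<^sup>2)
      - Poly_Mapping.single 1 (a * q ^ k) - Poly_Mapping.single (- 1) (a * q ^ k)) *
      aw_kernel a q k"
    unfolding qpoch_Suc by (metis (no_types, lifting) mult.commute mult.left_commute)
  then show ?thesis
    by (simp only: left_diff_distrib)
qed

lemma lookup_aw_kernel_Suc:
  "Poly_Mapping.lookup (aw_kernel a q (Suc k)) j =
     (1 + (a * q ^ k)\<^sup>2) * Poly_Mapping.lookup (aw_kernel a q k) j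
     - a * q ^ k * Poly_Mapping.lookup (aw_kernel a q k) (j - 1)
     - a * q ^ k * Poly_Mapping.lookup (aw_kernel a q k) (j + 1)"
  unfolding aw_kernel_Suc lookup_minus lookup_lconst_times lookup_single_times by simp

lemma aw_kernel_0: "aw_kernel a q 0 = 1"
  by (simp add: qpoch_def)

lemma symmetric_aw_kernel:
  "Poly_Mapping.lookup (aw_kernel a q k) (- j) = Poly_Mapping.lookup (aw_kernel a q k) j"
proof (induction k arbitrary: j)
  case 0
  show ?case unfolding aw_kernel_0 by (simp add: lookup_one)
next
  case (Suc k)
  have "Poly_Mapping.lookup (aw_kernel a q k) (- j - 1) =
        Poly_Mapping.lookup (aw_kernel a q k) (j + 1)"
    "Poly_Mapping.lookup (aw_kernel a q k) (- j + 1) =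
        Poly_Mapping.lookup (aw_kernel a q k) (j - 1)"
    using Suc[of "j + 1"] Suc[of "j - 1"] by simp_all
  then show ?case
    unfolding lookup_aw_kernel_Suc by (simp add: Suc)
qed

lemma aw_kernel_upper:
  "int k < j \<Longrightarrow> Poly_Mapping.lookup (aw_kernel a q k) j = 0"
proof (induction k arbitrary: j)
  case 0
  then show ?case unfolding aw_kernel_0 by (simp add: lookup_one)
next
  case (Suc k)
  then show ?case unfolding lookup_aw_kernel_Suc by simp
qed

lemma aw_kernel_diag:
  assumes "a \<noteq> 0" "q \<noteq> 0"
  shows "Poly_Mapping.lookup (aw_kernel a q k) (int k) \<noteq> 0"
proof (induction k)
  case 0
  show ?case unfolding aw_kernel_0 by simp
next
  case (Suc k)
  then show ?case unfolding lookup_aw_kernel_Suc using assms by (simp add: aw_kernel_upper)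
qed

text \<open>
  Symmetry and triangularity hold for any linear combination of the kernels; the explicit last
  coefficient serves to show that the degree is exactly \<open>n\<close>.
\<close>

lemma aw_poly_expansion:
  obtains s C where
    "\<And>j. Poly_Mapping.lookup (aw_poly a b c d q n) j =
       s * (\<Sum>k\<le>n. C k * Poly_Mapping.lookup (aw_kernel a q k) j)"
    "s = 1 / (a ^ n * qpoch (a * b * c * d * q powi (int n - 1)) q n)"
    "C n = qpoch (q powi (- int n)) q n * qpoch (q powi (int n - 1) * a * b * c * d) q n /
       qpoch q q n * q ^ n"
proof
  let ?C = "\<lambda>k. qpoch (q powi (- int n)) q k * qpoch (q powi (int n - 1) * a * b * c * d) q k *
                qpoch (a * b * q ^ k) q (n - k) * qpoch (a * c * q ^ k) q (n - k) *
                qpoch (a * d * q ^ k) q (n - k) / qpoch q q k * q ^ k"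
  show "Poly_Mapping.lookup (aw_poly a b c d q n) j =
       1 / (a ^ n * qpoch (a * b * c * d * q powi (int n - 1)) q n) *
       (\<Sum>k\<le>n. ?C k * Poly_Mapping.lookup (aw_kernel a q k) j)" for j
    unfolding aw_poly_def by (simp only: lookup_lconst_times lookup_sum mult.assoc)
  show "?C n = qpoch (q powi (- int n)) q n * qpoch (q powi (int n - 1) * a * b * c * d) q n /
       qpoch q q n * q ^ n"
    by (simp add: qpoch_def)
qed simp

lemma symmetric_aw_poly: "symmetric_laurent (aw_poly a b c d q n)"
proof -
  obtain s C where "\<And>j. Poly_Mapping.lookup (aw_poly a b c d q n) j =
       s * (\<Sum>k\<le>n. C k * Poly_Mapping.lookup (aw_kernel a q k) j)"
    by (rule aw_poly_expansion[of a b c d q n]) blast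
  then show ?thesis
    unfolding symmetric_laurent_def by (simp add: symmetric_aw_kernel)
qed

lemma aw_poly_upper:
  assumes "n < m"
  shows "Poly_Mapping.lookup (aw_poly a b c d q n) (int m) = 0"
proof -
  obtain s C where "\<And>j. Poly_Mapping.lookup (aw_poly a b c d q n) j =
       s * (\<Sum>k\<le>n. C k * Poly_Mapping.lookup (aw_kernel a q k) j)"
    by (rule aw_poly_expansion[of a b c d q n]) blast
  with assms show ?thesis by (simp add: aw_kernel_upper)
qed

locale aw_parameters =
  fixes a b c d q :: complex
  assumes a_nonzero: "a \<noteq> 0"
    and q_nonzero: "q \<noteq> 0"
    and q_not_root: "\<And>n. q ^ Suc n \<noteq> 1"
    and abcd_generic: "\<And>n. a * b * c * d * q ^ n \<noteq> 1"
begin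

lemma aw_poly_diag: "Poly_Mapping.lookup (aw_poly a b c d q n) (int n) \<noteq> 0"
proof -
  obtain s C where
    l: "\<And>j. Poly_Mapping.lookup (aw_poly a b c d q n) j =
       s * (\<Sum>k\<le>n. C k * Poly_Mapping.lookup (aw_kernel a q k) j)"
    and s: "s = 1 / (a ^ n * qpoch (a * b * c * d * q powi (int n - 1)) q n)"
    and C: "C n = qpoch (q powi (- int n)) q n *
      qpoch (q powi (int n - 1) * a * b * c * d) q n / qpoch q q n * q ^ n"
    by (rule aw_poly_expansion[of a b c d q n]) blast
  have abcd: "qpoch (a * b * c * d * q powi (int n - 1)) q n \<noteq> 0"
  proof (rule qpoch_nonzero)
    fix j assume "j < n"
    then have "q powi (int n - 1) = q ^ (n - 1)"
      by (simp flip: power_int_of_nat add: of_nat_diff)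
    then show "a * b * c * d * q powi (int n - 1) * q ^ j \<noteq> 1"
      using abcd_generic[of "n - 1 + j"] by (simp add: power_add mult.assoc)
  qed
  have "qpoch q q n \<noteq> 0"
    using q_not_root by (intro qpoch_nonzero) simp
  moreover have "qpoch (q powi (- int n)) q n \<noteq> 0"
  proof (rule qpoch_nonzero)
    fix j assume j: "j < n"
    have "q ^ n = q ^ j * q ^ Suc (n - j - 1)"
      unfolding power_add[symmetric] using j by (intro arg_cong[of _ _ "(^) q"]) simp
    with q_not_root[of "n - j - 1"] q_nonzero show "q powi (- int n) * q ^ j \<noteq> 1"
      by (auto simp: power_int_minus field_simps)
  qed
  moreover have "qpoch (q powi (int n - 1) * a * b * c * d) q n \<noteq> 0"
    using abcd by (simp add: ac_simps)
  ultimately have "C n \<noteq> 0"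
    unfolding C using q_nonzero by simp
  moreover have "(\<Sum>k\<le>n. C k * Poly_Mapping.lookup (aw_kernel a q k) (int n)) =
      C n * Poly_Mapping.lookup (aw_kernel a q n) (int n)"
    by (subst sum.remove[of _ n]) (auto intro!: sum.neutral simp: aw_kernel_upper)
  ultimately show ?thesis
    unfolding l using abcd a_nonzero aw_kernel_diag[OF a_nonzero q_nonzero] by (simp add: s)
qed

text \<open>The scalar may be zero, in which case both sides vanish.\<close>

lemma aw_coord_scaled:
  "aw_coord a b c d q (lconst s * aw_poly a b c d q n) = Poly_Mapping.single n s"
proof -
  let ?sum = "\<lambda>x. \<Sum>m\<in>Poly_Mapping.keys x.
    lconst (Poly_Mapping.lookup x m) * aw_poly a b c d q m"
  have eq: "lconst s * aw_poly a b c d q n = ?sum (Poly_Mapping.single n s)"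
    by (simp add: lconst_def)
  show ?thesis
    unfolding aw_coord_def
  proof (rule the_equality[where P = "\<lambda>x. _ = ?sum x"])
    fix x assume "lconst s * aw_poly a b c d q n = ?sum x"
    then have "?sum x = ?sum (Poly_Mapping.single n s)" using eq by simp
    then show "x = Poly_Mapping.single n s"
      using triangular_coord_unique[of "aw_poly a b c d q" x "Poly_Mapping.single n s"]
        aw_poly_diag aw_poly_upper by blast
  qed (rule eq)
qed

lemma aw_form_scaled:
  "aw_form a b c d q (lconst s * aw_poly a b c d q m) (lconst t * aw_poly a b c d q n) =
     (if m = n then s * t * aw_norm a b c d q n else 0)"
  unfolding aw_form_def aw_coord_scaled by (auto simp: Let_def)

lemma aw_form_orthogonal:
  "aw_form a b c d q (aw_poly a b c d q m) (aw_poly a b c d q n) =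
     (if m = n then aw_norm a b c d q n else 0)"
  using aw_form_scaled[of 1 m 1 n] by (simp add: lconst_def)

end

section \<open>Orthogonality of the nonsymmetric polynomials\<close>

text \<open>
  Each Pochhammer symbol of \<open>h\<^sub>n\<close> differs from its counterpart in the shifted \<open>h\<^sub>n\<^sub>-\<^sub>1\<close> by
  finitely many factors at its ends.
\<close>

lemma aw_norm_Suc:
  assumes "1 - q ^ Suc n * a * b \<noteq> 0"
  shows "aw_norm a b c d q (Suc n) =
    (1 - a * b) * (1 - q * a * b) * (1 - a * c) * (1 - a * d) * (1 - b * c) * (1 - b * d) /
      ((1 - a * b * c * d) * (1 - q * a * b * c * d)) *
    ((1 - q ^ Suc n) * (1 - q ^ n * c * d) /
      ((1 - q ^ Suc n * a * b) * (1 - q ^ n * a * b * c * d))) *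
    aw_norm (q * a) (q * b) c d q n"
proof -
  have "qpoch (a * b) q (Suc n) * (1 - q ^ Suc n * a * b) = qpoch (a * b) q (Suc (Suc n))"
    by (subst (2) qpoch_Suc) (simp add: ac_simps)
  also have "\<dots> = (1 - a * b) * (1 - q * a * b) * qpoch (q * a * (q * b)) q n"
    by (simp only: qpoch_Suc_shift) (simp add: ac_simps)
  finally have ab: "qpoch (a * b) q (Suc n) =
      (1 - a * b) * (1 - q * a * b) * qpoch (q * a * (q * b)) q n / (1 - q ^ Suc n * a * b)"
    using assms by (simp add: field_simps)
  have ac: "qpoch (x * y) q (Suc n) = (1 - x * y) * qpoch (q * x * y) q n" for x y
    by (simp add: qpoch_Suc_shift mult.assoc)
  have cd: "qpoch (c * d) q (Suc n) = qpoch (c * d) q n * (1 - q ^ n * c * d)"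
    by (simp add: qpoch_Suc ac_simps)
  have qq: "qpoch q q (Suc n) = qpoch q q n * (1 - q ^ Suc n)"
    by (simp add: qpoch_Suc)
  have "qpoch (a * b * c * d) q (2 * Suc n) = qpoch (a * b * c * d) q (Suc (Suc (2 * n)))"
    by simp
  also have "\<dots> = (1 - a * b * c * d) * (1 - q * a * b * c * d) *
      qpoch (q * a * (q * b) * c * d) q (2 * n)"
    by (simp only: qpoch_Suc_shift) (simp add: ac_simps)
  finally have abcd: "qpoch (a * b * c * d) q (2 * Suc n) =
      (1 - a * b * c * d) * (1 - q * a * b * c * d) * qpoch (q * a * (q * b) * c * d) q (2 * n)" .
  have "qpoch (q powi (int (Suc n) - 1) * a * b * c * d) q (Suc n) =
      (1 - q ^ n * a * b * c * d) * qpoch (q * (q ^ n * a * b * c * d)) q n"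
    by (simp add: qpoch_Suc_shift)
  also have "qpoch (q * (q ^ n * a * b * c * d)) q n =
      qpoch (q powi (int n - 1) * (q * a) * (q * b) * c * d) q n"
  proof (cases n)
    case (Suc k)
    then show ?thesis by (simp add: ac_simps)
  qed (simp add: qpoch_def)
  finally have den: "qpoch (q powi (int (Suc n) - 1) * a * b * c * d) q (Suc n) =
      (1 - q ^ n * a * b * c * d) * qpoch (q powi (int n - 1) * (q * a) * (q * b) * c * d) q n" .
  show ?thesis
    unfolding aw_norm_def ab ac[of a c] ac[of a d] ac[of b c] ac[of b d] cd qq abcd den by (simp only: times_divide_times_eq
      times_divide_eq_left times_divide_eq_right divide_divide_eq_left ac_simps)
qed

definition nonsym_scalar ::
    "complex \<Rightarrow> complex \<Rightarrow> complex \<Rightarrow> complex \<Rightarrow> complex \<Rightarrow> int \<Rightarrow> complex" where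
  "nonsym_scalar a b c d q n =
     (if n < 0 then - 1 / (a * b)
      else - ((1 - q powi n) * (1 - q powi (n - 1) * c * d) /
              ((1 - q powi n * a * b) * (1 - q powi (n - 1) * a * b * c * d))))"

text \<open>At \<open>n = 0\<close> the scalar is zero, so that the index \<open>nat \<bar>n\<bar> - 1 = 0\<close> is harmless there.\<close>

lemma nonsym_aw_poly_pair:
  assumes "a \<noteq> 0" "b \<noteq> 0"
  shows "nonsym_aw_poly a b c d q n = aw_poly a b c d q (nat \<bar>n\<bar>) +
    aw_factor a b * (lconst (nonsym_scalar a b c d q n) *
      aw_poly (q * a) (q * b) c d q (nat \<bar>n\<bar> - 1))"
proof -
  have lconst_minus: "lconst (- x) = - lconst x" for x
    by (simp add: lconst_def single_uminus)
  consider "n < 0" | "n = 0" | "n > 0" by linarith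
  then show ?thesis
  proof cases
    case 1
    then show ?thesis
      by (simp add: nonsym_aw_poly_def nonsym_scalar_def aw_Q_def lconst_minus ac_simps)
  next
    case 2
    then show ?thesis
      by (simp add: nonsym_aw_poly_def nonsym_scalar_def aw_Q_def lconst_def)
  next
    case 3
    define K where "K = (1 - q powi n) * (1 - q powi (n - 1) * c * d) /
      ((1 - q powi n * a * b) * (1 - q powi (n - 1) * a * b * c * d))"
    let ?P = "aw_factor a b * aw_poly (q * a) (q * b) c d q (nat n - 1)"
    have "lconst (a * b * K) * (lconst (1 / (a * b)) * ?P) = lconst K * ?P"
      using assms by (simp flip: mult.assoc lconst_mult)
    moreover have "a * b * (1 - q powi n) * (1 - q powi (n - 1) * c * d) /
      ((1 - q powi n * a * b) * (1 - q powi (n - 1) * a * b * c * d)) = a * b * K"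
      by (simp add: K_def mult.assoc)
    ultimately have "nonsym_aw_poly a b c d q n = aw_poly a b c d q (nat n) - lconst K * ?P"
      using 3 by (simp add: nonsym_aw_poly_def aw_Q_def mult.assoc)
    moreover have "nonsym_scalar a b c d q n = - K"
      using 3 by (simp add: nonsym_scalar_def K_def)
    ultimately show ?thesis
      using 3 by (simp add: lconst_minus mult.left_commute)
  qed
qed

text \<open>
  The two scalars of opposite indices multiply to the factor that occurs in \<open>aw_norm_Suc\<close>,
  which makes the contributions of the two components cancel.
\<close>

lemma nonsym_contributions_cancel:
  assumes ab: "a \<noteq> 0" "b \<noteq> 0" and n: "n \<noteq> 0"
    and generic: "\<And>k. q ^ Suc k * a * b \<noteq> 1"
  shows "aw_norm a b c d q (nat \<bar>n\<bar>) -
    a * b * ((1 - a * b) * (1 - q * a * b) * (1 - a * c) * (1 - a * d) * (1 - b * c) * (1 - b * d) /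
      ((1 - a * b * c * d) * (1 - q * a * b * c * d))) *
    (nonsym_scalar a b c d q n * nonsym_scalar a b c d q (- n) *
      aw_norm (q * a) (q * b) c d q (nat \<bar>n\<bar> - 1)) = 0"
proof -
  define k where "k = nat \<bar>n\<bar> - 1"
  have k: "nat \<bar>n\<bar> = Suc k" "\<bar>n\<bar> = int (Suc k)"
    using n by (simp_all add: k_def)
  define K where "K = (1 - q ^ Suc k) * (1 - q ^ k * c * d) /
      ((1 - q ^ Suc k * a * b) * (1 - q ^ k * a * b * c * d))"
  have pos: "nonsym_scalar a b c d q (int (Suc k)) = - K"
  proof -
    have "q powi (int (Suc k)) = q ^ Suc k" "q powi (int (Suc k) - 1) = q ^ k"
      by (simp_all only: power_int_of_nat of_nat_Suc add_diff_cancel_left' flip: of_nat_Suc) simp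
    then show ?thesis
      unfolding nonsym_scalar_def K_def by simp
  qed
  have neg: "nonsym_scalar a b c d q (- int (Suc k)) = - 1 / (a * b)"
    by (simp add: nonsym_scalar_def)
  have "n = int (Suc k) \<or> n = - int (Suc k)"
    using k by linarith
  then have "nonsym_scalar a b c d q n * nonsym_scalar a b c d q (- n) = K / (a * b)"
    using pos neg by (elim disjE) (simp_all only: minus_minus, simp_all)
  moreover have "1 - q ^ Suc k * a * b \<noteq> 0"
    using generic[of k] by simp
  note aw_norm_Suc[OF this, of c d, folded K_def]
  ultimately show ?thesis
    unfolding k(1) using ab by simp
qed

theorem mainTheorem2:
  fixes q :: real and a b c d :: complex
  assumes "0 < q" and "q < 1"
    and "a \<noteq> 0" and "b \<noteq> 0" and "c \<noteq> 0" and "d \<noteq> 0"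
    and "\<forall>m::nat. a * b * c * d \<noteq> complex_of_real q powi (- int m)"
    and "{a, b} \<inter> {inverse a, inverse b} = {}"
    and "\<forall>n::nat. n \<ge> 1 \<longrightarrow> complex_of_real q ^ n * a * b \<noteq> 1"
  shows "\<forall>m n :: int. m \<noteq> n \<longrightarrow>
    nonsym_aw_form a b c d (complex_of_real q)
      (nonsym_aw_poly a b c d (complex_of_real q) m)
      (nonsym_aw_poly a b c d (complex_of_real q) n) = 0"
proof (intro allI impI)
  fix m n :: int
  assume mn: "m \<noteq> n"
  define Q where "Q = complex_of_real q"
  have Q0: "Q \<noteq> 0" using assms(1) by (simp add: Q_def)
  have Q1: "Q ^ Suc k \<noteq> 1" for k
  proof -
    have "q ^ Suc k < 1" using assms(1,2) by (intro power_Suc_less_one) simp_all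
    then have "q ^ Suc k \<noteq> 1" by simp
    then show ?thesis unfolding Q_def of_real_power[symmetric] of_real_eq_1_iff .
  qed
  have generic: "a * b * c * d * Q ^ k \<noteq> 1" for k
  proof
    assume "a * b * c * d * Q ^ k = 1"
    then have "a * b * c * d = Q powi (- int k)"
      using Q0 by (simp add: power_int_minus field_simps)
    then show False using assms(7) by (simp add: Q_def)
  qed
  interpret P: aw_parameters a b c d Q
    by unfold_locales (use assms(3) Q0 Q1 generic in auto)
  interpret S: aw_parameters "Q * a" "Q * b" c d Q
  proof
    fix k
    show "Q * a * (Q * b) * c * d * Q ^ k \<noteq> 1"
      using generic[of "Suc (Suc k)"] by (simp add: ac_simps)
  qed (use assms(3) Q0 Q1 in auto)
  have ab: "a * b \<noteq> 1"
  proof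
    assume "a * b = 1"
    then have "b = inverse a" by (metis inverse_unique)
    then show False using assms(8) by blast
  qed
  have qab: "Q ^ Suc k * a * b \<noteq> 1" for k
    using assms(9)[rule_format, of "Suc k"] by (simp add: Q_def)
  have pair: "sym_pair a b (nonsym_aw_poly a b c d Q k) =
      (aw_poly a b c d Q (nat \<bar>k\<bar>),
       lconst (nonsym_scalar a b c d Q k) * aw_poly (Q * a) (Q * b) c d Q (nat \<bar>k\<bar> - 1))" for k
    unfolding nonsym_aw_poly_pair[OF assms(3,4)]
    by (intro sym_pair_eqI ab symmetric_aw_poly symmetric_lconst_times)
  note form = nonsym_aw_form_def pair Let_def prod.case P.aw_form_orthogonal S.aw_form_scaled
  have "nonsym_aw_form a b c d Q (nonsym_aw_poly a b c d Q m) (nonsym_aw_poly a b c d Q n) = 0"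
  proof (cases "m = - n")
    case True
    then have "n \<noteq> 0" using mn by simp
    from nonsym_contributions_cancel[OF assms(3,4) this qab]
    show ?thesis unfolding form True by (simp add: mult.commute)
  next
    case False
    then have "nat \<bar>m\<bar> \<noteq> nat \<bar>n\<bar>" using mn by linarith
    \<comment> \<open>Truncated subtraction identifies the second components of the indices 0 and \<open>\<plusminus>1\<close>;
      one of the two scalars is then zero.\<close>
    moreover have "nonsym_scalar a b c d Q m * nonsym_scalar a b c d Q n = 0"
      if "nat \<bar>m\<bar> - 1 = nat \<bar>n\<bar> - 1"
    proof -
      have "m = 0 \<or> n = 0" using that \<open>nat \<bar>m\<bar> \<noteq> nat \<bar>n\<bar>\<close> by linarith
      then show ?thesis by (auto simp: nonsym_scalar_def)
    qed
    ultimately show ?thesis unfolding form by auto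
  qed
  then show "nonsym_aw_form a b c d (complex_of_real q)
      (nonsym_aw_poly a b c d (complex_of_real q) m)
      (nonsym_aw_poly a b c d (complex_of_real q) n) = 0"
    by (simp add: Q_def)
qed

end
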